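(* Uniform detectability implies $\mathcal K^{\infty}$-exact detectability: if the system $x_{k+1}=F_kx_k+G_kx_kw_k$, $y_k=H_kx_k$, $k=0,1,2,\dots$, is uniformly detectable, then it is $\mathcal K^\infty$-exactly detectable.
   Context: $\{w_k\}_{k\ge 0}$ is a one-dimensional independent white noise process on a probability space, with $E w_k=0$, $E[w_kw_j]=\delta_{kj}$; $\mathcal F_k=\sigma(w_0,\dots,w_k)$ and $\mathcal F_{-1}$ is the trivial sigma-algebra; $l^2_{\mathcal F_k}$ is the set of $\mathcal F_k$-measurable random vectors $x$ with $E\|x\|^2<\infty$. $\mathcal N_0=\{0,1,2,\dots\}$. $F_k,G_k\in\mathbb R^{n\times n}$, $H_k\in\mathbb R^{m\times n}$ are deterministic real matrices; $x_k\in\mathbb R^n$, $y_k\in\mathbb R^m$. Uniform detectability: there exist integers $s,t\ge 0$ and constants $d,b$ with $0\le d<1$ and $0<b<\infty$ such that, for every $k\in\mathcal N_0$ and every state $x_k\in l^2_{\mathcal F_{k-1}}$ at time $k$ (with $x_{k+1},\dots$ and $y_k,\dots$ generated by the system from $x_k$), whenever $E\|x_{k+t}\|^2\ge d^2E\|x_k\|^2$ there holds $\sum_{i=k}^{k+s}E\|y_i\|^2\ge b^2E\|x_k\|^2$. A state $x_{k_0}\in l^2_{\mathcal F_{k_0-1}}$ at time $k_0$ is $k_0^\infty$-unobservable if the output generated from it satisfies $y_k=0$ a.s. for all $k\ge k_0$. The system is $k_0^\infty$-exactly detectable if there are constants $\beta\ge1$, $0<\lambda<1$ such that for every $k_0^\infty$-unobservable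 state $\xi$ the trajectory with $x_{k_0}=\xi$ satisfies $E\|x_k\|^2\le\beta E\|\xi\|^2\lambda^{k-k_0}$ for all $k\ge k_0$. The system is $\mathcal K^\infty$-exactly detectable if it is $k^\infty$-exactly detectable for every $k\ge0$. *)

theory Defs
  imports "HOL-Probability.Probability"
begin

locale white_noise = prob_space M for M :: "'a measure" +
  fixes w :: "nat \<Rightarrow> 'a \<Rightarrow> real"
  assumes indep: "indep_vars (\<lambda>_. borel) w UNIV"
    and square_integrable: "integrable M (\<lambda>\<omega>. (w k \<omega>)\<^sup>2)"
    and mean_zero: "expectation (w k) = 0"
    and covariance: "expectation (\<lambda>\<omega>. w k \<omega> * w j \<omega>) = (if k = j then 1 else 0)"

(* noise_past M w k is the sigma-algebra generated by w 0, ..., w (k - 1), i.e. the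
   F_{k-1} with respect to which the state at time k is measurable; for k = 0 it is trivial. *)
definition noise_past :: "'a measure \<Rightarrow> (nat \<Rightarrow> 'a \<Rightarrow> real) \<Rightarrow> nat \<Rightarrow> 'a measure" where
  "noise_past M w k = sigma (space M) {w i -` A \<inter> space M | i A. i < k \<and> A \<in> sets borel}"

lemma sets_noise_past_0: "sets (noise_past M w 0) = {{}, space M}"
  by (simp add: noise_past_def sigma_sets_empty_eq)

(* The square-integrable random vectors that are measurable with respect to F_{k-1}. *)
definition admissible_states ::
  "'a measure \<Rightarrow> (nat \<Rightarrow> 'a \<Rightarrow> real) \<Rightarrow> nat \<Rightarrow> ('a \<Rightarrow> real ^ 'n) set" where
  "admissible_states M w k =
    {x \<in> borel_measurable (noise_past M w k). integrable M (\<lambda>\<omega>. (norm (x \<omega>))\<^sup>2)}"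

(* state w F G k0 \<xi> k is the state at the absolute time k of the trajectory that equals
   \<xi> at time k0.  Times k < k0 carry no meaning; the value \<xi> there is a dummy. *)
primrec state ::
  "(nat \<Rightarrow> 'a \<Rightarrow> real) \<Rightarrow> (nat \<Rightarrow> real ^ 'n ^ 'n) \<Rightarrow> (nat \<Rightarrow> real ^ 'n ^ 'n) \<Rightarrow>
    nat \<Rightarrow> ('a \<Rightarrow> real ^ 'n) \<Rightarrow> nat \<Rightarrow> 'a \<Rightarrow> real ^ 'n" where
  "state w F G k0 \<xi> 0 = \<xi>"
| "state w F G k0 \<xi> (Suc k) =
    (if k < k0 then \<xi>
     else (\<lambda>\<omega>. F k *v state w F G k0 \<xi> k \<omega> + w k \<omega> *\<^sub>R (G k *v state w F G k0 \<xi> k \<omega>)))"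

lemma state_initial: "state w F G k0 \<xi> k0 = \<xi>"
  by (cases k0) simp_all

lemma state_step:
  "k0 \<le> k \<Longrightarrow> state w F G k0 \<xi> (Suc k) \<omega> =
    F k *v state w F G k0 \<xi> k \<omega> + w k \<omega> *\<^sub>R (G k *v state w F G k0 \<xi> k \<omega>)"
  by simp

definition output_at ::
  "(nat \<Rightarrow> 'a \<Rightarrow> real) \<Rightarrow> (nat \<Rightarrow> real ^ 'n ^ 'n) \<Rightarrow> (nat \<Rightarrow> real ^ 'n ^ 'n) \<Rightarrow>
    (nat \<Rightarrow> real ^ 'n ^ 'm) \<Rightarrow> nat \<Rightarrow> ('a \<Rightarrow> real ^ 'n) \<Rightarrow> nat \<Rightarrow> 'a \<Rightarrow> real ^ 'm" where
  "output_at w F G H k0 \<xi> k \<omega> = H k *v state w F G k0 \<xi> k \<omega>"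

definition mean_square :: "'a measure \<Rightarrow> ('a \<Rightarrow> 'b::real_normed_vector) \<Rightarrow> real" where
  "mean_square M x = (LINT \<omega>|M. (norm (x \<omega>))\<^sup>2)"

definition uniformly_detectable ::
  "'a measure \<Rightarrow> (nat \<Rightarrow> 'a \<Rightarrow> real) \<Rightarrow> (nat \<Rightarrow> real ^ 'n ^ 'n) \<Rightarrow> (nat \<Rightarrow> real ^ 'n ^ 'n) \<Rightarrow>
    (nat \<Rightarrow> real ^ 'n ^ 'm) \<Rightarrow> bool" where
  "uniformly_detectable M w F G H \<longleftrightarrow>
    (\<exists>(s::nat) (t::nat) (d::real) (b::real). 0 \<le> d \<and> d < 1 \<and> 0 < b \<and>
      (\<forall>k. \<forall>\<xi>\<in>admissible_states M w k.
        mean_square M (state w F G k \<xi> (k + t)) \<ge> d\<^sup>2 * mean_square M \<xi> \<longrightarrow>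
        (\<Sum>i=k..k+s. mean_square M (output_at w F G H k \<xi> i)) \<ge> b\<^sup>2 * mean_square M \<xi>))"

definition unobservable_states ::
  "'a measure \<Rightarrow> (nat \<Rightarrow> 'a \<Rightarrow> real) \<Rightarrow> (nat \<Rightarrow> real ^ 'n ^ 'n) \<Rightarrow> (nat \<Rightarrow> real ^ 'n ^ 'n) \<Rightarrow>
    (nat \<Rightarrow> real ^ 'n ^ 'm) \<Rightarrow> nat \<Rightarrow> ('a \<Rightarrow> real ^ 'n) set" where
  "unobservable_states M w F G H k0 =
    {\<xi> \<in> admissible_states M w k0. \<forall>k\<ge>k0. AE \<omega> in M. output_at w F G H k0 \<xi> k \<omega> = 0}"

definition exactly_detectable_from ::
  "'a measure \<Rightarrow> (nat \<Rightarrow> 'a \<Rightarrow> real) \<Rightarrow> (nat \<Rightarrow> real ^ 'n ^ 'n) \<Rightarrow> (nat \<Rightarrow> real ^ 'n ^ 'n) \<Rightarrow>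
    (nat \<Rightarrow> real ^ 'n ^ 'm) \<Rightarrow> nat \<Rightarrow> bool" where
  "exactly_detectable_from M w F G H k0 \<longleftrightarrow>
    (\<exists>(\<beta>::real) (\<rho>::real). 1 \<le> \<beta> \<and> 0 < \<rho> \<and> \<rho> < 1 \<and>
      (\<forall>\<xi>\<in>unobservable_states M w F G H k0. \<forall>k\<ge>k0.
        mean_square M (state w F G k0 \<xi> k) \<le> \<beta> * mean_square M \<xi> * \<rho> ^ (k - k0)))"

definition K_exactly_detectable ::
  "'a measure \<Rightarrow> (nat \<Rightarrow> 'a \<Rightarrow> real) \<Rightarrow> (nat \<Rightarrow> real ^ 'n ^ 'n) \<Rightarrow> (nat \<Rightarrow> real ^ 'n ^ 'n) \<Rightarrow>
    (nat \<Rightarrow> real ^ 'n ^ 'm) \<Rightarrow> bool" where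
  "K_exactly_detectable M w F G H \<longleftrightarrow> (\<forall>k. exactly_detectable_from M w F G H k)"

end

theory Submission
  imports Defs
begin

text \<open>
  A state on an unobservable trajectory is itself unobservable from its own time on, so the
  output energy that uniform detectability bounds from below vanishes at every time \<open>k\<close> of the
  trajectory.  Hence either \<open>x\<^sub>k\<close> is already zero in mean square, or the premise of the
  detectability condition fails and \<open>E\<parallel>x\<^bsub>k+t\<^esub>\<parallel>\<^sup>2 < d\<^sup>2 E\<parallel>x\<^sub>k\<parallel>\<^sup>2\<close>.  Either way
  \<open>E\<parallel>x\<^bsub>k+t\<^esub>\<parallel>\<^sup>2 \<le> d\<^sup>2 E\<parallel>x\<^sub>k\<parallel>\<^sup>2\<close>: the energy contracts over every block of length \<open>t\<close>
  (lemma \<open>unobservable_contraction\<close>).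

  Contraction over blocks yields exponential decay once the energy inside the first block is
  controlled by the initial energy.  One step of the system multiplies the energy by at most a
  constant depending on the coefficient matrices of that step (lemma \<open>mean_square_step_le\<close>), because
  \<open>w\<^sub>k\<close> has second moment one and is independent of the state \<open>x\<^sub>k\<close>.
  These constants may grow with \<open>k\<close>, but only the finitely many steps of the first block
  enter \<open>\<beta>\<close>, which may depend on the initial time.  The same independence keeps the trajectory
  inside the admissible states, which is what allows the detectability condition to be applied
  anew at each time.
\<close>

section \<open>Exponential decay of sequences contracting over blocks\<close>

lemma growth_le_prod:
  fixes a c :: "nat \<Rightarrow> real"
  assumes "\<And>j. 0 \<le> a j" "\<And>j. a (Suc j) \<le> c j * a j" "j \<le> t"
  shows "a j \<le> (\<Prod>i<t. max 1 (c i)) * a 0"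
proof -
  have "a j \<le> (\<Prod>i<j. max 1 (c i)) * a 0" for j
  proof (induction j)
    case (Suc j)
    have "a (Suc j) \<le> max 1 (c j) * a j"
      using assms(1)[of j] assms(2)[of j] by (smt (verit) mult_right_mono)
    also have "\<dots> \<le> max 1 (c j) * ((\<Prod>i<j. max 1 (c i)) * a 0)"
      using Suc by (intro mult_left_mono) auto
    finally show ?case by (simp add: mult_ac)
  qed simp
  moreover have "(\<Prod>i<j. max 1 (c i)) \<le> (\<Prod>i<t. max 1 (c i))"
    using assms(3) by (intro prod_mono2) (auto intro: order_trans[of 0 1])
  ultimately show ?thesis
    using assms(1)[of 0] by (meson mult_right_mono order_trans)
qed

text \<open>
  The rate \<open>\<rho>\<close> is the \<open>t\<close>-th root of the block factor, so that a block of length \<open>t\<close> costs exactly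
  \<open>\<rho> ^ t\<close>, and \<open>\<beta>\<close> absorbs the growth within the first block.  The constants
  are chosen before the sequence, since exact detectability asks for one pair \<open>\<beta>\<close>, \<open>\<rho>\<close>
  that serves all unobservable states.
\<close>
lemma uniform_exponential_decay:
  fixes c :: "nat \<Rightarrow> real" and q :: real and t :: nat
  assumes "q < 1"
  obtains \<beta> \<rho> :: real where "1 \<le> \<beta>" "0 < \<rho>" "\<rho> < 1"
    "\<And>a j. (\<And>i. 0 \<le> a i) \<Longrightarrow> (\<And>i. a (Suc i) \<le> c i * a i) \<Longrightarrow> (\<And>i. a (i + t) \<le> q * a i)
      \<Longrightarrow> a j \<le> \<beta> * a 0 * \<rho> ^ j"
proof (cases "t = 0")
  case True
  \<comment> \<open>Contraction over a block of length zero forces the sequence to vanish.\<close>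
  have "a j \<le> 1 * a 0 * (1/2) ^ j" if "\<And>i. 0 \<le> a i" "\<And>i. a (i + t) \<le> q * a i"
    for a :: "nat \<Rightarrow> real" and j
  proof -
    have "(1 - q) * a j \<le> 0"
      using that(2)[of j] True by (simp add: algebra_simps)
    then have "a j \<le> 0"
      using assms by (simp add: mult_le_0_iff)
    also have "0 \<le> 1 * a 0 * (1/2) ^ j"
      using that(1)[of 0] by simp
    finally show ?thesis .
  qed
  then show ?thesis
    by (intro that[of 1 "1/2"]) auto
next
  case False
  \<comment> \<open>The block factor may be zero or negative, but the rate has to be positive.\<close>
  define p where "p = max q (1/2)"
  define \<rho> where "\<rho> = root t p"
  define C where "C = (\<Prod>i<t. max 1 (c i))"
  define \<beta> where "\<beta> = C / p"
  have p: "0 < p" "p < 1" "q \<le> p"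
    using assms by (auto simp: p_def)
  have \<rho>: "0 < \<rho>" "\<rho> < 1" "\<rho> ^ t = p"
    using False p by (auto simp: \<rho>_def)
  have C: "1 \<le> C"
    unfolding C_def by (intro prod_ge_1) auto
  have \<beta>: "1 \<le> \<beta>"
    using C p by (simp add: \<beta>_def)
  have "a j \<le> \<beta> * a 0 * \<rho> ^ j"
    if a: "\<And>i. 0 \<le> a i" "\<And>i. a (Suc i) \<le> c i * a i" "\<And>i. a (i + t) \<le> q * a i"
    for a :: "nat \<Rightarrow> real" and j
  proof (induction j rule: less_induct)
    case (less j)
    show ?case
    proof (cases "j < t")
      case True
      have "p \<le> \<rho> ^ j"
        using True \<rho> power_decreasing[of j t \<rho>] by simp
      then have "C \<le> \<beta> * \<rho> ^ j"
        using C p by (simp add: \<beta>_def field_simps)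
      moreover have "a j \<le> C * a 0"
        using growth_le_prod[of a c j t] a True by (simp add: C_def)
      ultimately show ?thesis
        using a(1)[of 0] by (smt (verit) mult.assoc mult.commute mult_right_mono)
    next
      case False
      then obtain i where i: "j = i + t"
        by (metis add.commute le_Suc_ex not_less)
      have "a j \<le> p * a i"
        using a(1)[of i] a(3)[of i] p i by (smt (verit) mult_right_mono)
      also have "\<dots> \<le> p * (\<beta> * a 0 * \<rho> ^ i)"
        using less[of i] i \<open>t \<noteq> 0\<close> p by (intro mult_left_mono) auto
      finally show ?thesis
        by (simp add: i power_add \<rho>(3) mult_ac)
    qed
  qed
  then show ?thesis
    using that[of \<beta> \<rho>] \<beta> \<rho> by blast
qed

section \<open>Independence of the noise and its past\<close>

context white_noise
begin

lemma random_variable_noise [measurable]: "w k \<in> borel_measurable M"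
  using indep by (auto simp: indep_vars_def)

lemma noise_past_generators:
  "{w i -` A \<inter> space M | i A. i < k \<and> A \<in> sets borel} \<subseteq> Pow (space M)"
  by auto

lemma space_noise_past: "space (noise_past M w k) = space M"
  unfolding noise_past_def by (simp add: space_measure_of[OF noise_past_generators])

lemma sets_noise_past:
  "sets (noise_past M w k) =
    sigma_sets (space M) {w i -` A \<inter> space M | i A. i < k \<and> A \<in> sets borel}"
  unfolding noise_past_def by (simp add: sets_measure_of[OF noise_past_generators])

lemma subalgebra_noise_past: "subalgebra M (noise_past M w k)"
  unfolding subalgebra_def sets_noise_past space_noise_past
  by (intro conjI refl sets.sigma_sets_subset) auto

lemma subalgebra_noise_past_Suc: "subalgebra (noise_past M w (Suc k)) (noise_past M w k)"
  unfolding subalgebra_def sets_noise_past space_noise_past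
  by (intro conjI refl sigma_sets_mono') (blast intro: less_SucI)

lemma noise_measurable_past_Suc: "w k \<in> borel_measurable (noise_past M w (Suc k))"
proof (rule measurableI)
  fix A :: "real set" assume "A \<in> sets borel"
  then show "w k -` A \<inter> space (noise_past M w (Suc k)) \<in> sets (noise_past M w (Suc k))"
    unfolding sets_noise_past space_noise_past by (intro sigma_sets.Basic) auto
qed simp

text \<open>
  Grouping the independent family of the \<open>\<sigma>\<close>-algebras generated by the \<open>w\<^sub>i\<close> into
  the blocks \<open>{k}\<close> and \<open>{..<k}\<close> makes the generated \<open>\<sigma>\<close>-algebras
  independent, and \<open>Y\<close> generates a part of the second one.
\<close>
lemma indep_var_noise_past:
  assumes Y: "Y \<in> borel_measurable (noise_past M w k)"
  shows "indep_var borel (w k) borel (Y :: 'a \<Rightarrow> real)"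
proof -
  define E where "E i = {w i -` A \<inter> space M | A. A \<in> sets borel}" for i
  define I where "I b = (if b then {k} else {..<k})" for b
  have Y_M: "Y \<in> borel_measurable M"
    using measurable_from_subalg[OF subalgebra_noise_past Y] .
  have "indep_sets E UNIV"
    using indep unfolding indep_vars_def2 E_def by simp
  then have E: "indep_sets E (\<Union>b\<in>UNIV. I b)"
    by (rule indep_sets_mono_index[rotated]) auto
  have "Int_stable (E i)" for i
  proof (rule Int_stableI)
    fix a b assume "a \<in> E i" "b \<in> E i"
    then obtain A B where "A \<in> sets borel" "B \<in> sets borel"
      "a = w i -` A \<inter> space M" "b = w i -` B \<inter> space M"
      unfolding E_def by auto
    then show "a \<inter> b \<in> E i"
      unfolding E_def by (auto intro!: exI[of _ "A \<inter> B"])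
  qed
  moreover have "disjoint_family_on I UNIV"
    by (auto simp: disjoint_family_on_def I_def)
  ultimately have ind: "indep_sets (\<lambda>b. sigma_sets (space M) (\<Union>i\<in>I b. E i)) UNIV"
    using E by (intro indep_sets_collect_sigma) auto
  have past: "(\<Union>i\<in>I False. E i) = {w i -` A \<inter> space M | i A. i < k \<and> A \<in> sets borel}"
    by (auto simp: I_def E_def)
  have "sigma_sets (space M) {Y -` A \<inter> space M | A. A \<in> sets borel}
      \<subseteq> sets (noise_past M w k)"
    using measurable_sets[OF Y]
    by (intro sets.sigma_sets_subset[where M = "noise_past M w k", unfolded space_noise_past])
       (auto simp: space_noise_past)
  then have sub: "sigma_sets (space M) {Y -` A \<inter> space M | A. A \<in> sets borel}
      \<subseteq> sigma_sets (space M) (\<Union>i\<in>I False. E i)"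
    by (simp add: past sets_noise_past)
  have "indep_set (sigma_sets (space M) {w k -` A \<inter> space M | A. A \<in> sets borel})
      (sigma_sets (space M) {Y -` A \<inter> space M | A. A \<in> sets borel})"
    unfolding indep_set_def
  proof (rule indep_sets_mono_sets[OF ind])
    fix b
    show "(case b of True \<Rightarrow> sigma_sets (space M) {w k -` A \<inter> space M | A. A \<in> sets borel}
        | False \<Rightarrow> sigma_sets (space M) {Y -` A \<inter> space M | A. A \<in> sets borel})
      \<subseteq> sigma_sets (space M) (\<Union>i\<in>I b. E i)"
      using sub by (cases b) (auto simp: I_def E_def)
  qed
  then show ?thesis
    using Y_M by (simp add: indep_var_eq)
qed

lemma noise_square_times_past:
  fixes Y :: "'a \<Rightarrow> real"
  assumes Y: "Y \<in> borel_measurable (noise_past M w k)" and int: "integrable M Y"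
  shows "integrable M (\<lambda>\<omega>. (w k \<omega>)\<^sup>2 * Y \<omega>)"
    and "expectation (\<lambda>\<omega>. (w k \<omega>)\<^sup>2 * Y \<omega>) = expectation Y"
proof -
  have "indep_var borel ((\<lambda>x. x\<^sup>2) \<circ> w k) borel ((\<lambda>x. x) \<circ> Y)"
    by (rule indep_var_compose[OF indep_var_noise_past[OF Y]]) auto
  then have ind: "indep_var borel (\<lambda>\<omega>. (w k \<omega>)\<^sup>2) borel Y"
    by (simp add: o_def)
  show "integrable M (\<lambda>\<omega>. (w k \<omega>)\<^sup>2 * Y \<omega>)"
    using indep_var_integrable[OF ind square_integrable int] .
  show "expectation (\<lambda>\<omega>. (w k \<omega>)\<^sup>2 * Y \<omega>) = expectation Y"
    using indep_var_lebesgue_integral[OF ind square_integrable int] covariance[of k k]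
    by (simp add: power2_eq_square)
qed

end

section \<open>Mean-square growth of trajectories\<close>

definition step_gain :: "(nat \<Rightarrow> real ^ 'n ^ 'n) \<Rightarrow> (nat \<Rightarrow> real ^ 'n ^ 'n) \<Rightarrow> nat \<Rightarrow> real"
  where "step_gain F G k = 2 * (onorm ((*v) (F k)))\<^sup>2 + 2 * (onorm ((*v) (G k)))\<^sup>2"

lemma borel_measurable_matrix_vector_mult:
  fixes A :: "real ^ 'n ^ 'm"
  assumes "x \<in> borel_measurable N"
  shows "(\<lambda>\<omega>. A *v x \<omega>) \<in> borel_measurable N"
proof (rule measurable_compose[OF assms])
  show "(*v) A \<in> borel_measurable borel"
    by (intro borel_measurable_continuous_onI linear_continuous_on)
       (rule matrix_vector_mul_bounded_linear)
qed

context white_noise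
begin

text \<open>
  Only the energy is estimated, so the mixed term in \<open>F x + w G x\<close> is absorbed by
  \<open>\<parallel>u + v\<parallel>\<^sup>2 \<le> 2 \<parallel>u\<parallel>\<^sup>2 + 2 \<parallel>v\<parallel>\<^sup>2\<close>.  What remains to integrate is
  \<open>w\<^sup>2 \<parallel>x\<parallel>\<^sup>2\<close>, a product of independent variables.
\<close>
lemma
  fixes A B :: "real ^ 'n ^ 'n"
  assumes x: "x \<in> admissible_states M w k"
  defines "y \<equiv> \<lambda>\<omega>. A *v x \<omega> + w k \<omega> *\<^sub>R (B *v x \<omega>)"
  shows admissible_step: "y \<in> admissible_states M w (Suc k)"
    and mean_square_step_le:
      "mean_square M y \<le> (2 * (onorm ((*v) A))\<^sup>2 + 2 * (onorm ((*v) B))\<^sup>2) * mean_square M x"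
proof -
  let ?a = "onorm ((*v) A)" and ?b = "onorm ((*v) B)"
  let ?X = "\<lambda>\<omega>. (norm (x \<omega>))\<^sup>2"
  let ?bound = "\<lambda>\<omega>. 2 * ?a\<^sup>2 * ?X \<omega> + 2 * ?b\<^sup>2 * ((w k \<omega>)\<^sup>2 * ?X \<omega>)"
  have x_past: "x \<in> borel_measurable (noise_past M w k)" and X_int: "integrable M ?X"
    using x by (auto simp: admissible_states_def)
  have X_past: "?X \<in> borel_measurable (noise_past M w k)"
    using x_past by measurable
  note wX = noise_square_times_past[OF X_past X_int]
  have "x \<in> borel_measurable (noise_past M w (Suc k))"
    using measurable_from_subalg[OF subalgebra_noise_past_Suc x_past] .
  then have y_past: "y \<in> borel_measurable (noise_past M w (Suc k))"
    unfolding y_def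
    by (intro borel_measurable_add borel_measurable_scaleR noise_measurable_past_Suc
        borel_measurable_matrix_vector_mult)
  then have y_M: "y \<in> borel_measurable M"
    by (rule measurable_from_subalg[OF subalgebra_noise_past])
  have bound: "(norm (y \<omega>))\<^sup>2 \<le> ?bound \<omega>" for \<omega>
  proof -
    let ?u = "norm (A *v x \<omega>)" and ?v = "norm (w k \<omega> *\<^sub>R (B *v x \<omega>))"
    have u: "?u \<le> ?a * norm (x \<omega>)"
      by (rule onorm) (rule matrix_vector_mul_bounded_linear)
    have "norm (B *v x \<omega>) \<le> ?b * norm (x \<omega>)"
      by (rule onorm) (rule matrix_vector_mul_bounded_linear)
    then have v: "?v \<le> \<bar>w k \<omega>\<bar> * (?b * norm (x \<omega>))"
      by (simp add: mult_left_mono)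
    have "(norm (y \<omega>))\<^sup>2 \<le> (?u + ?v)\<^sup>2"
      unfolding y_def by (intro power_mono norm_triangle_ineq norm_ge_zero)
    also have "\<dots> \<le> 2 * ?u\<^sup>2 + 2 * ?v\<^sup>2"
      using zero_le_power2[of "?u - ?v"] unfolding power2_sum power2_diff by linarith
    also have "\<dots> \<le> 2 * (?a * norm (x \<omega>))\<^sup>2 + 2 * (\<bar>w k \<omega>\<bar> * (?b * norm (x \<omega>)))\<^sup>2"
      by (intro add_mono mult_left_mono power_mono u v norm_ge_zero) auto
    also have "\<dots> = ?bound \<omega>"
      by (simp add: power_mult_distrib mult_ac)
    finally show ?thesis .
  qed
  have bound_int: "integrable M ?bound"
    using X_int wX(1) by (intro Bochner_Integration.integrable_add integrable_mult_right)
  have y_int: "integrable M (\<lambda>\<omega>. (norm (y \<omega>))\<^sup>2)"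
  proof (rule Bochner_Integration.integrable_bound[OF bound_int])
    show "(\<lambda>\<omega>. (norm (y \<omega>))\<^sup>2) \<in> borel_measurable M"
      using y_M by measurable
    show "AE \<omega> in M. norm ((norm (y \<omega>))\<^sup>2) \<le> norm (?bound \<omega>)"
      using bound by (auto intro!: AE_I2 order_trans[OF bound])
  qed
  show "y \<in> admissible_states M w (Suc k)"
    using y_past y_int by (simp add: admissible_states_def)
  have "mean_square M y \<le> expectation ?bound"
    unfolding mean_square_def using y_int bound_int bound by (intro integral_mono) auto
  also have "\<dots> = 2 * ?a\<^sup>2 * expectation ?X + 2 * ?b\<^sup>2 * expectation (\<lambda>\<omega>. (w k \<omega>)\<^sup>2 * ?X \<omega>)"
    using X_int wX(1) by (subst Bochner_Integration.integral_add) auto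
  also have "\<dots> = (2 * ?a\<^sup>2 + 2 * ?b\<^sup>2) * mean_square M x"
    by (simp only: wX(2) mean_square_def distrib_right)
  finally show "mean_square M y \<le> (2 * ?a\<^sup>2 + 2 * ?b\<^sup>2) * mean_square M x" .
qed

lemma admissible_state:
  fixes F G :: "nat \<Rightarrow> real ^ 'n ^ 'n"
  assumes "\<xi> \<in> admissible_states M w k0"
  shows "state w F G k0 \<xi> (k0 + j) \<in> admissible_states M w (k0 + j)"
proof (induction j)
  case 0
  then show ?case using assms by (simp add: state_initial)
next
  case (Suc j)
  then show ?case using admissible_step[OF Suc, of "F (k0 + j)" "G (k0 + j)"] by simp
qed

lemma mean_square_state_Suc_le:
  assumes "\<xi> \<in> admissible_states M w k0"
  shows "mean_square M (state w F G k0 \<xi> (Suc (k0 + j)))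
    \<le> step_gain F G (k0 + j) * mean_square M (state w F G k0 \<xi> (k0 + j))"
  using mean_square_step_le[OF admissible_state[OF assms, of F G j], of "F (k0 + j)" "G (k0 + j)"]
  by (simp add: step_gain_def)

end

lemma state_restart:
  "state w F G (k0 + j) (state w F G k0 \<xi> (k0 + j)) (k0 + j + i) = state w F G k0 \<xi> (k0 + j + i)"
proof (induction i)
  case 0
  show ?case by (simp only: add_0_right state_initial)
next
  case (Suc i)
  then show ?case by simp
qed

lemma mean_square_nonneg: "0 \<le> mean_square M x"
  by (simp add: mean_square_def)

lemma mean_square_eq_0_AE:
  assumes "AE \<omega> in M. x \<omega> = 0"
  shows "mean_square M x = 0"
proof -
  have "AE \<omega> in M. (norm (x \<omega>))\<^sup>2 = 0"
    using assms by eventually_elim simp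
  then show ?thesis
    unfolding mean_square_def by (rule integral_eq_zero_AE)
qed

section \<open>Unobservable trajectories\<close>

lemma (in white_noise) unobservable_state:
  assumes "\<xi> \<in> unobservable_states M w F G H k0"
  shows "state w F G k0 \<xi> (k0 + j) \<in> unobservable_states M w F G H (k0 + j)"
proof -
  have "AE \<omega> in M. output_at w F G H (k0 + j) (state w F G k0 \<xi> (k0 + j)) k \<omega> = 0"
    if "k0 + j \<le> k" for k
  proof -
    obtain i where k: "k = k0 + j + i"
      using le_Suc_ex[OF \<open>k0 + j \<le> k\<close>] by blast
    have "AE \<omega> in M. output_at w F G H k0 \<xi> k \<omega> = 0"
      using assms that by (simp add: unobservable_states_def)
    then show ?thesis
      by (simp only: output_at_def k state_restart)
  qed
  moreover have "\<xi> \<in> admissible_states M w k0"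
    using assms by (simp add: unobservable_states_def)
  ultimately show ?thesis
    unfolding unobservable_states_def by (blast intro: admissible_state)
qed

text \<open>
  An unobservable state produces no output energy, so it meets the premise of the detectability
  condition only if its own energy is zero.  In that case the one-step growth bound keeps the
  energy at zero for all later times, so the contraction holds there too.
\<close>
lemma (in white_noise) unobservable_contraction:
  assumes unobs: "\<xi> \<in> unobservable_states M w F G H k"
    and "0 < b"
    and detect: "d\<^sup>2 * mean_square M \<xi> \<le> mean_square M (state w F G k \<xi> (k + t)) \<Longrightarrow>
      b\<^sup>2 * mean_square M \<xi> \<le> (\<Sum>i=k..k+s. mean_square M (output_at w F G H k \<xi> i))"
  shows "mean_square M (state w F G k \<xi> (k + t)) \<le> d\<^sup>2 * mean_square M \<xi>"
proof (rule ccontr)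
  assume not_le: "\<not> ?thesis"
  have "(\<Sum>i=k..k+s. mean_square M (output_at w F G H k \<xi> i)) = 0"
    using unobs by (intro sum.neutral) (auto simp: unobservable_states_def intro!: mean_square_eq_0_AE)
  then have "b\<^sup>2 * mean_square M \<xi> \<le> 0"
    using detect not_le by simp
  then have zero: "mean_square M \<xi> = 0"
    using \<open>0 < b\<close> mean_square_nonneg[of M \<xi>] by (simp add: mult_le_0_iff)
  have "\<xi> \<in> admissible_states M w k"
    using unobs by (simp add: unobservable_states_def)
  then have "mean_square M (state w F G k \<xi> (k + t)) \<le> 0"
    using growth_le_prod[of "\<lambda>j. mean_square M (state w F G k \<xi> (k + j))"
        "\<lambda>j. step_gain F G (k + j)" t t]
    by (simp add: mean_square_nonneg mean_square_state_Suc_le state_initial zero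
        del: state.simps)
  then show False
    using not_le zero by simp
qed

theorem lemma3p1p3:
  fixes M :: "'a measure" and w :: "nat \<Rightarrow> 'a \<Rightarrow> real"
    and F G :: "nat \<Rightarrow> real ^ 'n ^ 'n" and H :: "nat \<Rightarrow> real ^ 'n ^ 'm"
  assumes "white_noise M w"
    and "uniformly_detectable M w F G H"
  shows "K_exactly_detectable M w F G H"
proof -
  interpret white_noise M w by fact
  obtain s t d b where "0 \<le> d" "d < 1" and b: "0 < b" and detect:
    "\<And>k \<xi>. \<xi> \<in> admissible_states M w k \<Longrightarrow>
      d\<^sup>2 * mean_square M \<xi> \<le> mean_square M (state w F G k \<xi> (k + t)) \<Longrightarrow>
      b\<^sup>2 * mean_square M \<xi> \<le> (\<Sum>i=k..k+s. mean_square M (output_at w F G H k \<xi> i))"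
    using assms(2) unfolding uniformly_detectable_def by blast
  then have "d\<^sup>2 < 1"
    by (simp add: power_less_one_iff abs_square_less_1)
  have "exactly_detectable_from M w F G H k0" for k0
  proof -
    obtain \<beta> \<rho> :: real where \<beta>\<rho>: "1 \<le> \<beta>" "0 < \<rho>" "\<rho> < 1" and decay:
      "\<And>a j. (\<And>i. 0 \<le> a i) \<Longrightarrow> (\<And>i. a (Suc i) \<le> step_gain F G (k0 + i) * a i) \<Longrightarrow>
        (\<And>i. a (i + t) \<le> d\<^sup>2 * a i) \<Longrightarrow> a j \<le> \<beta> * a 0 * \<rho> ^ j"
      using uniform_exponential_decay[OF \<open>d\<^sup>2 < 1\<close>, of "\<lambda>i. step_gain F G (k0 + i)" t]
      by blast
    have "mean_square M (state w F G k0 \<xi> k) \<le> \<beta> * mean_square M \<xi> * \<rho> ^ (k - k0)"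
      if \<xi>: "\<xi> \<in> unobservable_states M w F G H k0" and "k0 \<le> k" for \<xi> k
    proof -
      let ?a = "\<lambda>j. mean_square M (state w F G k0 \<xi> (k0 + j))"
      have admissible: "\<xi> \<in> admissible_states M w k0"
        using \<xi> by (simp add: unobservable_states_def)
      have "?a (i + t) \<le> d\<^sup>2 * ?a i" for i
      proof -
        let ?x = "state w F G k0 \<xi> (k0 + i)"
        have "mean_square M (state w F G (k0 + i) ?x (k0 + i + t)) \<le> d\<^sup>2 * mean_square M ?x"
          using unobservable_contraction[OF unobservable_state[OF \<xi>] b
              detect[OF admissible_state[OF admissible]]] .
        then show ?thesis
          by (simp only: state_restart add.assoc[symmetric])
      qed
      then have "?a (k - k0) \<le> \<beta> * ?a 0 * \<rho> ^ (k - k0)"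
        using mean_square_state_Suc_le[OF admissible]
        by (intro decay[of ?a]) (simp_all add: mean_square_nonneg del: state.simps)
      then show ?thesis
        using \<open>k0 \<le> k\<close> by (simp add: state_initial)
    qed
    then show ?thesis
      unfolding exactly_detectable_from_def using \<beta>\<rho> by blast
  qed
  then show ?thesis
    by (simp add: K_exactly_detectable_def)
qed

end
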